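(* Let $d\ge 1$ and let $Y$ be a nonempty effective $\mathbb Z^d$-subshift. Then the equality problem "$X=Y$ for effective inputs $X$" is $D(\Sigma^0_1)$-hard.
   Context: For a finite alphabet $\mathcal A$ (a finite subset of $\mathbb N$), a pattern is a function $p\colon S\to\mathcal A$ with $S\subset\mathbb Z^d$ finite; it appears in $x\in\mathcal A^{\mathbb Z^d}$ if there is $u\in\mathbb Z^d$ with $x(u+s)=p(s)$ for all $s\in S$. For a set $\mathcal F$ of patterns, $X_{\mathcal F}$ is the set of configurations in which no pattern from $\mathcal F$ appears. A subshift is a set of the form $X_{\mathcal F}$ (possibly empty); it is effective if $\mathcal F$ can be taken recursively enumerable. The subshift $Y$ is a fixed parameter. The problem is: given an effective $\mathbb Z^d$-subshift $X$ on an arbitrary finite alphabet, specified by the alphabet and a Turing machine enumerating a defining set of forbidden patterns, determine whether $X=Y$. A set belongs to $D(\Sigma^0_1)$ when it is the difference of two $\Sigma^0_1$ sets; hardness is with respect to many-one reductions. *)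

theory Defs
  imports
    "HOL-Analysis.Finite_Cartesian_Product"
    "HOL-Library.Nat_Bijection"
    "HOL-Library.Countable_Set"
begin

section \<open>Turing machines\<close>

text \<open>
  Machines have finitely many tapes, each infinite in both directions; the symbol 0 is the blank.
  An instruction \<open>(q, i, a, q', b, m)\<close> reads: in state \<open>q\<close>, if the head of tape \<open>i\<close> scans \<open>a\<close>,
  write \<open>b\<close> there, move that head by \<open>m\<close> and enter state \<open>q'\<close>. A machine is a start state together
  with a finite list of instructions, which bounds the tapes, states and symbols it uses.
  The first applicable instruction is executed, so machines are deterministic; a machine halts when
  no instruction is applicable.
\<close>

datatype move = Move_Left | Move_Right | No_Move

type_synonym instruction = "nat \<times> nat \<times> nat \<times> nat \<times> nat \<times> move"
type_synonym machine = "nat \<times> instruction list"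

text \<open>A tape is given by the head position and the cell contents.\<close>

type_synonym tape = "int \<times> (int \<Rightarrow> nat)"
type_synonym tm_config = "nat \<times> (nat \<Rightarrow> tape)"

definition scanned :: "tape \<Rightarrow> nat" where
  "scanned t = snd t (fst t)"

fun shift_head :: "move \<Rightarrow> int \<Rightarrow> int" where
  "shift_head Move_Left z = z - 1"
| "shift_head Move_Right z = z + 1"
| "shift_head No_Move z = z"

definition act :: "nat \<Rightarrow> move \<Rightarrow> tape \<Rightarrow> tape" where
  "act b m t = (shift_head m (fst t), (snd t)(fst t := b))"

definition applicable :: "tm_config \<Rightarrow> instruction \<Rightarrow> bool" where
  "applicable c = (\<lambda>(q, i, a, q', b, m). q = fst c \<and> a = scanned (snd c i))"

definition execute :: "tm_config \<Rightarrow> instruction \<Rightarrow> tm_config" where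
  "execute c = (\<lambda>(q, i, a, q', b, m). (q', (snd c)(i := act b m (snd c i))))"

definition tm_step :: "machine \<Rightarrow> tm_config \<Rightarrow> tm_config option" where
  "tm_step M c = map_option (execute c) (find (applicable c) (snd M))"

text \<open>
  Numbers are represented in unary: the head is on the first of \<open>n\<close> cells containing 1, followed
  by a blank. The \<open>i\<close>-th argument is on tape \<open>i\<close>; the result is read off tape 0.
\<close>

definition input_tapes :: "nat list \<Rightarrow> nat \<Rightarrow> tape" where
  "input_tapes xs i =
     (0, \<lambda>z. if i < length xs \<and> 0 \<le> z \<and> z < int (xs ! i) then 1 else 0)"

definition holds_number :: "tape \<Rightarrow> nat \<Rightarrow> bool" where
  "holds_number t n \<longleftrightarrow>
     (\<forall>i<n. snd t (fst t + int i) = 1) \<and> snd t (fst t + int n) = 0"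

definition outputs :: "machine \<Rightarrow> nat list \<Rightarrow> nat \<Rightarrow> bool" where
  "outputs M xs y \<longleftrightarrow>
     (\<exists>q T. (\<lambda>c c'. tm_step M c = Some c')\<^sup>*\<^sup>* (fst M, input_tapes xs) (q, T) \<and>
            tm_step M (q, T) = None \<and> holds_number (T 0) y)"

definition computable :: "(nat \<Rightarrow> nat) \<Rightarrow> bool" where
  "computable f \<longleftrightarrow> (\<exists>M. \<forall>n. outputs M [n] (f n))"

definition decidable2 :: "(nat \<Rightarrow> nat \<Rightarrow> bool) \<Rightarrow> bool" where
  "decidable2 R \<longleftrightarrow> (\<exists>M. \<forall>n k. outputs M [n, k] (of_bool (R n k)))"

text \<open>
  The set enumerated by a machine: all results of its halting computations on inputs
  \<open>0, 1, 2, \<dots>\<close>. The machine need not halt on every input, so the empty set is included.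
\<close>

definition enumerated_set :: "machine \<Rightarrow> nat set" where
  "enumerated_set M = {y. \<exists>k. outputs M [k] y}"


section \<open>The class \<open>D(\<Sigma>\<^sup>0\<^sub>1)\<close> and many-one hardness\<close>

definition Sigma01 :: "nat set set" where
  "Sigma01 = {S. \<exists>R. decidable2 R \<and> S = {n. \<exists>k. R n k}}"

definition D_Sigma01 :: "nat set set" where
  "D_Sigma01 = {A - B | A B. A \<in> Sigma01 \<and> B \<in> Sigma01}"

text \<open>
  A decision problem consists of its set of (codes of) instances and its set of positive instances.
  A reduction to it has to produce instances only.
\<close>

type_synonym problem = "nat set \<times> nat set"

definition many_one_reducible :: "nat set \<Rightarrow> problem \<Rightarrow> bool" where
  "many_one_reducible S P \<longleftrightarrow>
     (\<exists>f. computable f \<and> (\<forall>n. f n \<in> fst P \<and> (n \<in> S \<longleftrightarrow> f n \<in> snd P)))"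

definition hard_for :: "nat set set \<Rightarrow> problem \<Rightarrow> bool" where
  "hard_for C P \<longleftrightarrow> (\<forall>S\<in>C. many_one_reducible S P)"


section \<open>Subshifts\<close>

type_synonym 'd configuration = "int ^ 'd \<Rightarrow> nat"
type_synonym 'd pattern = "int ^ 'd \<rightharpoonup> nat"

definition patterns :: "nat set \<Rightarrow> 'd::finite pattern set" where
  "patterns A = {p. finite (dom p) \<and> ran p \<subseteq> A}"

definition appears_in :: "'d::finite pattern \<Rightarrow> 'd configuration \<Rightarrow> bool" where
  "appears_in p x \<longleftrightarrow> (\<exists>u. \<forall>s\<in>dom p. p s = Some (x (u + s)))"

definition subshift :: "nat set \<Rightarrow> 'd::finite pattern set \<Rightarrow> 'd configuration set" where
  "subshift A F = {x. range x \<subseteq> A \<and> (\<forall>p\<in>F. \<not> appears_in p x)}"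

text \<open>
  Codes of patterns. The enumeration \<open>from_nat_into UNIV\<close> of the index type is an arbitrary one;
  another choice permutes the coordinates and hence changes the codes by a computable bijection.
\<close>

definition vector_code :: "int ^ 'd::finite \<Rightarrow> nat" where
  "vector_code v =
     list_encode (map (\<lambda>i. int_encode (v $ from_nat_into UNIV i)) [0..<CARD('d)])"

definition pattern_code :: "'d::finite pattern \<Rightarrow> nat" where
  "pattern_code p = set_encode ((\<lambda>(s, a). prod_encode (vector_code s, a)) ` Map.graph p)"

definition enumerates_patterns :: "machine \<Rightarrow> 'd::finite pattern set \<Rightarrow> bool" where
  "enumerates_patterns M F \<longleftrightarrow> enumerated_set M = pattern_code ` F"

definition effective_subshift :: "'d::finite configuration set \<Rightarrow> bool" where
  "effective_subshift X \<longleftrightarrow>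
     (\<exists>A F M. finite A \<and> F \<subseteq> patterns A \<and> enumerates_patterns M F \<and> X = subshift A F)"


section \<open>The equality problem\<close>

fun move_code :: "move \<Rightarrow> nat" where
  "move_code Move_Left = 0"
| "move_code Move_Right = 1"
| "move_code No_Move = 2"

definition instruction_code :: "instruction \<Rightarrow> nat" where
  "instruction_code =
     (\<lambda>(q, i, a, q', b, m). list_encode [q, i, a, q', b, move_code m])"

definition machine_code :: "machine \<Rightarrow> nat" where
  "machine_code M = prod_encode (fst M, list_encode (map instruction_code (snd M)))"

text \<open>
  \<open>specifies c X\<close>: the number \<open>c\<close> codes a finite alphabet and a machine enumerating a set of
  patterns over it, and \<open>X\<close> is the subshift defined by forbidding these patterns.
\<close>

definition specifies :: "nat \<Rightarrow> 'd::finite configuration set \<Rightarrow> bool" where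
  "specifies c X \<longleftrightarrow>
     (\<exists>A M F. finite A \<and> F \<subseteq> patterns A \<and> enumerates_patterns M F \<and>
        c = prod_encode (set_encode A, machine_code M) \<and> X = subshift A F)"

definition equality_problem :: "'d::finite configuration set \<Rightarrow> problem" where
  "equality_problem Y =
     ({c. \<exists>X :: 'd configuration set. specifies c X},
      {c. \<exists>X :: 'd configuration set. specifies c X \<and> X = Y})"

end

theory Submission
  imports Defs
begin

text \<open>
  Let \<open>Y\<close> be given by the patterns \<open>F\<close> over \<open>A\<close> and let \<open>\<star> \<notin> A\<close>. For \<open>S = S\<^sub>1 - S\<^sub>2\<close> with \<open>S\<^sub>1\<close> and
  \<open>S\<^sub>2\<close> in \<open>\<Sigma>\<^sup>0\<^sub>1\<close>, map \<open>n\<close> to the subshift over \<open>A \<union> {\<star>}\<close> that forbids \<open>F\<close>, forbids the symbol \<open>\<star>\<close> as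
  soon as \<open>n\<close> has been enumerated into \<open>S\<^sub>1\<close>, and forbids the empty pattern as soon as \<open>n\<close> has been
  enumerated into \<open>S\<^sub>2\<close>. In the last case the result is empty, hence not \<open>Y\<close>; otherwise it contains
  the constant configuration \<open>\<star>\<close> if \<open>n \<notin> S\<^sub>1\<close>, and is \<open>Y\<close> if \<open>n \<in> S\<^sub>1\<close>. No dovetailing is needed,
  since the enumerating machine may branch on its input modulo 3.

  For the code of the enumerating machine to be a computable function of \<open>n\<close>, the machine is a fixed
  instruction list preceded by \<open>n\<close> instructions that write \<open>n\<close> on a tape: its code arises by
  primitive recursion from the pairing function. Primitive recursion is carried out by Turing
  machines using each tape as a counter.
\<close>

section \<open>Machines on head-relative tapes\<close>

text \<open>Only the tape contents relative to the head matter, and passing to them turns the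
  translation invariance of computations into equality.\<close>

type_synonym vconfig = "nat \<times> (nat \<Rightarrow> int \<Rightarrow> nat)"

definition view :: "tape \<Rightarrow> int \<Rightarrow> nat" where
  "view t z = snd t (fst t + z)"

text \<open>The head stays at the origin, so moving it shifts the contents the opposite way.\<close>

definition vact :: "nat \<Rightarrow> move \<Rightarrow> (int \<Rightarrow> nat) \<Rightarrow> int \<Rightarrow> nat" where
  "vact b m v = (\<lambda>z. (v(0 := b)) (shift_head m z))"

definition vstep :: "instruction list \<Rightarrow> vconfig \<Rightarrow> vconfig option" where
  "vstep L c =
     map_option (\<lambda>(q, i, a, q', b, m). (q', (snd c)(i := vact b m (snd c i))))
       (find (\<lambda>(q, i, a, q', b, m). q = fst c \<and> a = snd c i 0) L)"

definition runs :: "instruction list \<Rightarrow> vconfig \<Rightarrow> vconfig \<Rightarrow> bool" where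
  "runs L = (\<lambda>c c'. vstep L c = Some c')\<^sup>*\<^sup>*"

text \<open>The counterpart of \<open>outputs\<close> for an arbitrary starting configuration, so
  that a result can be traced through the phases of a composite machine.\<close>

definition results :: "instruction list \<Rightarrow> vconfig \<Rightarrow> nat \<Rightarrow> bool" where
  "results L c y \<longleftrightarrow>
     (\<exists>q V. runs L c (q, V) \<and> vstep L (q, V) = None \<and>
            (\<forall>i<y. V 0 (int i) = 1) \<and> V 0 (int y) = 0)"

definition num :: "nat \<Rightarrow> int \<Rightarrow> nat" where
  "num n z = (if 0 \<le> z \<and> z < int n then 1 else 0)"

definition ctr :: "(nat \<Rightarrow> nat) \<Rightarrow> nat \<Rightarrow> int \<Rightarrow> nat" where
  "ctr s i = num (s i)"

text \<open>A blank tape represents 0, so missing arguments read as 0 and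
  \<open>ctr (regs xs)\<close> is the view of \<open>input_tapes xs\<close>.\<close>

definition regs :: "nat list \<Rightarrow> nat \<Rightarrow> nat" where
  "regs xs i = (if i < length xs then xs ! i else 0)"

definition abs_config :: "tm_config \<Rightarrow> vconfig" where
  "abs_config c = (fst c, \<lambda>i. view (snd c i))"

lemma view_act: "view (act b m t) = vact b m (view t)"
  by (cases m) (auto simp: view_def vact_def act_def fun_eq_iff algebra_simps)

text \<open>An instruction tests only the scanned cell and changes the tape relative to the head, so
  abstraction commutes with steps; halting is preserved and reflected.\<close>

lemma vstep_abs_config: "vstep (snd M) (abs_config c) = map_option abs_config (tm_step M c)"
proof -
  have "(\<lambda>(q, i, a, q', b, m). q = fst (abs_config c) \<and> a = snd (abs_config c) i 0)
        = applicable c"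
    by (auto simp: fun_eq_iff applicable_def abs_config_def view_def scanned_def)
  moreover have "(\<lambda>(q, i, a, q', b, m).
      (q', (snd (abs_config c))(i := vact b m (snd (abs_config c) i)))) ins
    = abs_config (execute c ins)" for ins
    by (cases ins) (auto simp: execute_def abs_config_def fun_eq_iff view_act)
  ultimately show ?thesis
    unfolding vstep_def tm_step_def option.map_comp comp_def by (intro option.map_cong) simp_all
qed

section \<open>Runs and results on views\<close>

lemma runs_refl [simp]: "runs L c c"
  by (simp add: runs_def)

lemma runs_trans [trans]: "runs L c c' \<Longrightarrow> runs L c' c'' \<Longrightarrow> runs L c c''"
  unfolding runs_def by (rule rtranclp_trans)

lemma runs_step: "vstep L c = Some c' \<Longrightarrow> runs L c' c'' \<Longrightarrow> runs L c c''"
  unfolding runs_def by (rule converse_rtranclp_into_rtranclp)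

lemma runs_abs_configI:
  assumes "(\<lambda>c c'. tm_step M c = Some c')\<^sup>*\<^sup>* c c'"
  shows "runs (snd M) (abs_config c) (abs_config c')"
  using assms
proof induction
  case (step d e)
  then have "runs (snd M) (abs_config d) (abs_config e)"
    by (auto intro: runs_step simp: vstep_abs_config)
  then show ?case using step.IH runs_trans by blast
qed simp

text \<open>\<open>abs_config\<close> forgets head positions and is not injective, but a step of an
  abstracted configuration is the abstraction of a concrete step, so runs lift one step at a
  time.\<close>

lemma runs_abs_configD:
  assumes "runs (snd M) (abs_config c) d"
  shows "\<exists>c'. (\<lambda>c c'. tm_step M c = Some c')\<^sup>*\<^sup>* c c' \<and> d = abs_config c'"
  using assms unfolding runs_def
proof induction
  case (step d e)
  then obtain c' where c': "(\<lambda>c c'. tm_step M c = Some c')\<^sup>*\<^sup>* c c'" "d = abs_config c'" by blast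
  obtain c'' where "tm_step M c' = Some c''" "e = abs_config c''"
    using step.hyps(2) c'(2) by (auto simp: vstep_abs_config)
  then show ?case
    by (intro exI[of _ c''] conjI rtranclp.rtrancl_into_rtrancl[OF c'(1)])
qed (intro exI[of _ c] conjI rtranclp.rtrancl_refl refl)

lemma outputs_iff_results: "outputs M xs y \<longleftrightarrow> results (snd M) (fst M, ctr (regs xs)) y"
proof -
  have init: "(fst M, ctr (regs xs)) = abs_config (fst M, input_tapes xs)"
    by (auto simp: abs_config_def ctr_def regs_def num_def view_def input_tapes_def fun_eq_iff)
  have final: "holds_number (T 0) y \<longleftrightarrow>
      (\<forall>i<y. view (T 0) (int i) = 1) \<and> view (T 0) (int y) = 0" for T :: "nat \<Rightarrow> tape"
    by (simp add: holds_number_def view_def)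
  have halt: "vstep (snd M) (abs_config c) = None \<longleftrightarrow> tm_step M c = None" for c
    by (simp add: vstep_abs_config)
  show ?thesis
  proof
    assume "outputs M xs y"
    then obtain q T where *: "(\<lambda>c c'. tm_step M c = Some c')\<^sup>*\<^sup>* (fst M, input_tapes xs) (q, T)"
      "tm_step M (q, T) = None" "holds_number (T 0) y"
      by (auto simp: outputs_def)
    show "results (snd M) (fst M, ctr (regs xs)) y"
      unfolding results_def init
      using runs_abs_configI[OF *(1)] halt[of "(q, T)"] *(2,3) final[of T]
      by (auto simp: abs_config_def)
  next
    assume "results (snd M) (fst M, ctr (regs xs)) y"
    then obtain d where d: "runs (snd M) (abs_config (fst M, input_tapes xs)) d"
      "vstep (snd M) d = None" "\<forall>i<y. snd d 0 (int i) = 1" "snd d 0 (int y) = 0"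
      by (auto simp: results_def init)
    then obtain q T where "(\<lambda>c c'. tm_step M c = Some c')\<^sup>*\<^sup>* (fst M, input_tapes xs) (q, T)"
      "d = abs_config (q, T)"
      using runs_abs_configD[OF d(1)] by auto
    with d halt[of "(q, T)"] final[of T] show "outputs M xs y"
      by (auto simp: outputs_def abs_config_def)
  qed
qed

text \<open>Determinism: a halting run from \<open>c\<close> passes through every configuration
  reachable from \<open>c\<close>.\<close>

lemma results_cong_runs:
  assumes "runs L c c'"
  shows "results L c y \<longleftrightarrow> results L c' y"
proof
  assume "results L c' y"
  then show "results L c y"
    using assms runs_trans unfolding results_def by blast
next
  \<comment> \<open>The halting run cannot end where a step is possible, and its first step agrees
    with that of the run to \<open>c'\<close>.\<close>
  have lin: "runs L c' d" if "runs L c d" "vstep L d = None" for d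
    using assms that unfolding runs_def
  proof (induction rule: converse_rtranclp_induct)
    case (step a b)
    from step.prems(1) show ?case
    proof (cases rule: converse_rtranclpE)
      case base
      then show ?thesis using step by simp
    next
      case (step x)
      then show ?thesis using \<open>vstep L a = Some b\<close> step.IH \<open>vstep L d = None\<close> by simp
    qed
  qed simp
  assume "results L c y"
  then show "results L c' y" using lin unfolding results_def by blast
qed

section \<open>Concatenation of instruction lists\<close>

lemma find_append: "find P (A @ B) = (case find P A of None \<Rightarrow> find P B | Some x \<Rightarrow> Some x)"
  by (induction A) auto

lemma vstep_append1: "vstep A c = Some c' \<Longrightarrow> vstep (A @ B) c = Some c'"
  by (auto simp: vstep_def find_append)

lemma vstep_None: "fst c \<notin> fst ` set A \<Longrightarrow> vstep A c = None"
  by (force simp: vstep_def find_None_iff)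

lemma vstep_append2: "fst c \<notin> fst ` set A \<Longrightarrow> vstep (A @ B) c = vstep B c"
  using vstep_None[of c A] by (auto simp: vstep_def find_append)

lemma vstep_append3: "fst c \<notin> fst ` set B \<Longrightarrow> vstep (A @ B) c = vstep A c"
  using vstep_None[of c B] by (auto simp: vstep_def find_append split: option.split)

lemma runs_mono:
  assumes "runs A c c'" and "\<And>d d'. vstep A d = Some d' \<Longrightarrow> vstep B d = Some d'"
  shows "runs B c c'"
  using assms(1) unfolding runs_def
proof induction
  case (step d e)
  then show ?case using assms(2) by (meson rtranclp.rtrancl_into_rtrancl)
qed simp

lemma runs_append1: "runs A c c' \<Longrightarrow> runs (A @ B) c c'"
  by (erule runs_mono) (rule vstep_append1)

text \<open>A prefix takes precedence over \<open>B\<close>, so it must have no instruction for the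
  states from which \<open>B\<close> acts.\<close>

lemma runs_append2:
  assumes "fst ` set A \<inter> fst ` set B = {}" "runs B c c'"
  shows "runs (A @ B) c c'"
  using assms(2)
proof (rule runs_mono)
  fix d d' :: vconfig
  assume *: "vstep B d = Some d'"
  then have "fst d \<in> fst ` set B" using vstep_None[of d B] by auto
  then have "fst d \<notin> fst ` set A" using assms(1) by auto
  then show "vstep (A @ B) d = Some d'" using * by (simp add: vstep_append2)
qed

text \<open>A computation starting in \<open>S\<close> stays in \<open>S\<close>, where both lists
  have the same steps and the same halting configurations.\<close>

lemma results_restrict:
  assumes "\<And>c. fst c \<in> S \<Longrightarrow> vstep L' c = vstep L c"
    and "\<And>c c'. fst c \<in> S \<Longrightarrow> vstep L c = Some c' \<Longrightarrow> fst c' \<in> S"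
    and "fst c \<in> S"
  shows "results L' c y \<longleftrightarrow> results L c y"
proof -
  have 1: "runs L c d \<and> fst d \<in> S" if "runs L' c d" for d
    using that unfolding runs_def
    by induction (use assms in \<open>auto intro: rtranclp.rtrancl_into_rtrancl\<close>)
  have 2: "runs L' c d \<and> fst d \<in> S" if "runs L c d" for d
    using that unfolding runs_def
    by induction (use assms in \<open>auto intro: rtranclp.rtrancl_into_rtrancl\<close>)
  have "runs L' c (q, V) \<and> vstep L' (q, V) = None \<longleftrightarrow> runs L c (q, V) \<and> vstep L (q, V) = None"
    for q V
    using 1[of "(q, V)"] 2[of "(q, V)"] assms(1)[of "(q, V)"] by auto
  then show ?thesis
    unfolding results_def by (simp only: conj_assoc[symmetric])
qed

definition closed_in :: "nat set \<Rightarrow> instruction list \<Rightarrow> bool" where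
  "closed_in S L \<longleftrightarrow> (\<forall>(q, i, a, q', b, m)\<in>set L. q \<in> S \<and> q' \<in> S)"

lemma vstep_closed_in: "closed_in S L \<Longrightarrow> vstep L c = Some c' \<Longrightarrow> fst c' \<in> S"
  by (induction L) (auto simp: closed_in_def vstep_def split: if_splits)

lemma closed_in_sources: "closed_in S L \<Longrightarrow> fst ` set L \<subseteq> S"
  by (auto simp: closed_in_def)

text \<open>No foreign instruction applies in \<open>S\<close>, and \<open>L\<close> never leaves
  \<open>S\<close>. The equivalence, rather than an implication, is what rules out spurious elements
  of an enumerated set.\<close>

lemma results_embed:
  assumes "closed_in S L" "fst c \<in> S" "fst ` set A \<inter> S = {}" "fst ` set B \<inter> S = {}"
  shows "results (A @ L @ B) c y \<longleftrightarrow> results L c y"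
proof (rule results_restrict[where S = S])
  fix c :: vconfig
  assume "fst c \<in> S"
  then have "fst c \<notin> fst ` set A" "fst c \<notin> fst ` set B" using assms(3,4) by blast+
  then show "vstep (A @ L @ B) c = vstep L c"
    by (simp add: vstep_append2 vstep_append3)
qed (use assms vstep_closed_in in auto)

section \<open>Relocation of states and tapes\<close>

definition relocate :: "(nat \<Rightarrow> nat) \<Rightarrow> nat \<Rightarrow> instruction list \<Rightarrow> instruction list" where
  "relocate t s L = map (\<lambda>(q, i, a, q', b, m). (q + s, t i, a, q' + s, b, m)) L"

text \<open>The map \<open>e\<close> places the tapes of the small machine among those of the large
  one: tape \<open>i\<close> is found at \<open>t i\<close>, and writing commutes with
  \<open>e\<close>.\<close>

lemma vstep_relocate:
  assumes "\<And>U i. e U (t i) = U i" and "\<And>U i v. (e U)(t i := v) = e (U(i := v))"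
  shows "vstep (relocate t s L) (q + s, e U) =
         map_option (\<lambda>(q', U'). (q' + s, e U')) (vstep L (q, U))"
  by (induction L) (auto simp: vstep_def relocate_def assms split: prod.splits)

lemma runs_relocate:
  assumes "\<And>U i. e U (t i) = U i" and "\<And>U i v. (e U)(t i := v) = e (U(i := v))"
    and "runs L c c'"
  shows "runs (relocate t s L) (fst c + s, e (snd c)) (fst c' + s, e (snd c'))"
  using assms(3) unfolding runs_def
proof induction
  case (step d d')
  have "vstep (relocate t s L) (fst d + s, e (snd d)) = Some (fst d' + s, e (snd d'))"
    using vstep_relocate[of e t s L "fst d" "snd d"] assms(1,2) step.hyps(2)
    by (simp add: case_prod_beta)
  then show ?case using step.IH by (rule rtranclp.rtrancl_into_rtrancl[rotated])
qed simp

text \<open>Runs are pulled back as well as pushed forward: from a shifted state, the relocated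
  machine visits shifted states only.\<close>

lemma results_relocate_id:
  "results (relocate id s L) (q + s, U) y \<longleftrightarrow> results L (q, U) y"
proof -
  have step: "vstep (relocate id s L) (q + s, U) =
      map_option (\<lambda>(q', U'). (q' + s, U')) (vstep L (q, U))" for q U
    using vstep_relocate[of id id s L q U] by simp
  have fwd: "runs (relocate id s L) (q + s, U) (q' + s, U')" if "runs L (q, U) (q', U')" for q' U'
    using runs_relocate[of id id L "(q, U)" "(q', U')" s] that by simp
  have bwd: "\<exists>q' U'. d = (q' + s, U') \<and> runs L (q, U) (q', U')"
    if "runs (relocate id s L) (q + s, U) d" for d
    using that unfolding runs_def
  proof induction
    case base
    then show ?case by auto
  next
    case (step d e)
    then obtain q' U' where d: "d = (q' + s, U')"
      "(\<lambda>c c'. vstep L c = Some c')\<^sup>*\<^sup>* (q, U) (q', U')" by blast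
    obtain q'' U'' where "vstep L (q', U') = Some (q'', U'')" "e = (q'' + s, U'')"
      using step.hyps(2) d(1) vstep_relocate[of id id s L q' U']
      by (cases "vstep L (q', U')") auto
    with d(2) show ?case
      by (intro exI[of _ q''] exI[of _ U''] conjI rtranclp.rtrancl_into_rtrancl[OF d(2)])
  qed
  show ?thesis
  proof
    assume "results L (q, U) y"
    then obtain q' U' where d: "runs L (q, U) (q', U')" "vstep L (q', U') = None"
      "\<forall>i<y. U' 0 (int i) = 1" "U' 0 (int y) = 0"
      by (auto simp: results_def)
    show "results (relocate id s L) (q + s, U) y"
      unfolding results_def
      by (intro exI[of _ "q' + s"] exI[of _ U'] conjI fwd d) (simp add: step d)
  next
    assume "results (relocate id s L) (q + s, U) y"
    then obtain d where d: "runs (relocate id s L) (q + s, U) d"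
      "vstep (relocate id s L) d = None" "\<forall>i<y. snd d 0 (int i) = 1" "snd d 0 (int y) = 0"
      by (auto simp: results_def)
    then obtain q' U' where "d = (q' + s, U')" "runs L (q, U) (q', U')"
      using bwd by blast
    with d step show "results L (q, U) y" by (auto simp: results_def)
  qed
qed

lemma states_bounded: "\<exists>N. closed_in {..<N} L \<and> q < N"
proof -
  have "\<exists>N. closed_in {..<N} L"
  proof (induction L)
    case (Cons a L)
    then obtain N where "closed_in {..<N} L" by blast
    moreover obtain q i x q' b m where "a = (q, i, x, q', b, m)" by (cases a)
    ultimately have "closed_in {..<N + q + q' + 1} (a # L)"
      by (fastforce simp: closed_in_def)
    then show ?case by blast
  qed (auto simp: closed_in_def)
  then obtain N where "closed_in {..<N} L" by blast
  then have "closed_in {..<N + q + 1} L" by (fastforce simp: closed_in_def)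
  then show ?thesis by (intro exI[of _ "N + q + 1"]) auto
qed

lemma closed_in_relocate:
  "closed_in {..<N} L \<Longrightarrow> closed_in {s..<s + N} (relocate t s L)"
  by (auto simp: closed_in_def relocate_def case_prod_beta)

section \<open>Counter programs\<close>

text \<open>The program is available at every offset \<open>s\<close>, with entry \<open>s\<close>
  and exit \<open>e\<close>. The exit is not a source state, so a continuation can be attached
  there; \<open>Q\<close> is a precondition on the counters.\<close>

definition transforms :: "((nat \<Rightarrow> nat) \<Rightarrow> bool) \<Rightarrow> ((nat \<Rightarrow> nat) \<Rightarrow> nat \<Rightarrow> nat) \<Rightarrow> bool" where
  "transforms Q g \<longleftrightarrow>
     (\<forall>s. \<exists>L e. s \<le> e \<and> fst ` set L \<subseteq> {s..<e} \<and> closed_in {s..e} L \<and>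
        (\<forall>\<sigma>. Q \<sigma> \<longrightarrow> runs L (s, ctr \<sigma>) (e, ctr (g \<sigma>))))"

text \<open>A counter that is being incremented has its head one cell to the left of the block of ones.\<close>

definition lnum :: "nat \<Rightarrow> int \<Rightarrow> nat" where
  "lnum n z = num n (z - 1)"

lemma num_0: "num n 0 = (if n = 0 then 0 else 1)"
  by (simp add: num_def)

lemma lnum_0 [simp]: "lnum n 0 = 0"
  by (simp add: lnum_def num_def)

lemma lnum_of_0: "lnum 0 = num 0"
  by (auto simp: lnum_def num_def fun_eq_iff)

lemma vact_No_Move: "vact b No_Move v = v(0 := b)"
  by (auto simp: vact_def fun_eq_iff)

lemma vact_dec: "vact 0 Move_Right (num (Suc n)) = num n"
  by (auto simp: vact_def num_def fun_eq_iff)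

lemma vact_left: "vact (num n 0) Move_Left (num n) = lnum n"
  by (auto simp: vact_def num_def lnum_def fun_eq_iff)

lemma vact_lnum_write: "vact 1 Move_Left (lnum n) = lnum (Suc n)"
  by (auto simp: vact_def num_def lnum_def fun_eq_iff)

lemma vact_lnum_right: "vact 0 Move_Right (lnum n) = num n"
  by (auto simp: vact_def num_def lnum_def fun_eq_iff)

lemma lnum_write: "(lnum n)(0 := 1) = num (Suc n)"
  by (auto simp: num_def lnum_def fun_eq_iff)

lemma ctr_upd: "ctr (\<sigma>(r := k)) = (ctr \<sigma>)(r := num k)"
  by (auto simp: ctr_def fun_eq_iff)

lemma transforms_mono:
  "transforms Q g \<Longrightarrow> (\<And>\<sigma>. Q' \<sigma> \<Longrightarrow> Q \<sigma> \<and> g' \<sigma> = g \<sigma>) \<Longrightarrow> transforms Q' g'"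
  unfolding transforms_def by metis

lemma transforms_skip: "transforms (\<lambda>_. True) (\<lambda>\<sigma>. \<sigma>)"
  unfolding transforms_def
  by (intro allI exI[of _ "[]"]) (auto simp: closed_in_def)

lemma transforms_inc: "transforms (\<lambda>_. True) (\<lambda>\<sigma>. \<sigma>(r := Suc (\<sigma> r)))"
  unfolding transforms_def
proof (intro allI)
  fix s :: nat
  \<comment> \<open>The scanned symbol is 1 or 0 according to whether the counter is positive. In
    both cases it is kept while the head steps left onto a blank, which then becomes the new first
    1.\<close>
  let ?L = "[(s, r, 0, s + 1, 0, Move_Left), (s, r, 1, s + 1, 1, Move_Left),
    (s + 1, r, 0, s + 2, 1, No_Move)] :: instruction list"
  have "runs ?L (s, ctr \<sigma>) (s + 2, ctr (\<sigma>(r := Suc (\<sigma> r))))" for \<sigma>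
  proof -
    have "vstep ?L (s, ctr \<sigma>) = Some (s + 1, (ctr \<sigma>)(r := lnum (\<sigma> r)))"
      using vact_left[of "\<sigma> r"] by (simp add: vstep_def ctr_def num_0 split: if_splits)
    moreover have "vstep ?L (s + 1, (ctr \<sigma>)(r := lnum (\<sigma> r)))
        = Some (s + 2, ctr (\<sigma>(r := Suc (\<sigma> r))))"
      by (simp add: vstep_def vact_No_Move lnum_write[simplified] ctr_upd)
    ultimately show ?thesis by (meson runs_step runs_refl)
  qed
  then show "\<exists>L e. s \<le> e \<and> fst ` set L \<subseteq> {s..<e} \<and> closed_in {s..e} L \<and>
      (\<forall>\<sigma>. True \<longrightarrow> runs L (s, ctr \<sigma>) (e, ctr (\<sigma>(r := Suc (\<sigma> r)))))"
    by (intro exI[of _ ?L] exI[of _ "s + 2"]) (auto simp: closed_in_def)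
qed

text \<open>The exit of the first program is the entry of the second, and their source states are
  disjoint. The last hypothesis also absorbs changes of precondition and of the description of the
  result.\<close>

lemma transforms_seq:
  assumes "transforms Q g" "transforms R h"
    and *: "\<And>\<sigma>. P \<sigma> \<Longrightarrow> Q \<sigma> \<and> R (g \<sigma>) \<and> f \<sigma> = h (g \<sigma>)"
  shows "transforms P f"
  unfolding transforms_def
proof (intro allI)
  fix s
  obtain A m where A: "s \<le> m" "fst ` set A \<subseteq> {s..<m}" "closed_in {s..m} A"
    "\<And>\<sigma>. Q \<sigma> \<Longrightarrow> runs A (s, ctr \<sigma>) (m, ctr (g \<sigma>))"
    using assms(1) unfolding transforms_def by meson
  obtain B e where B: "m \<le> e" "fst ` set B \<subseteq> {m..<e}" "closed_in {m..e} B"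
    "\<And>\<sigma>. R \<sigma> \<Longrightarrow> runs B (m, ctr \<sigma>) (e, ctr (h \<sigma>))"
    using assms(2) unfolding transforms_def by meson
  have disj: "fst ` set A \<inter> fst ` set B = {}" using A(2) B(2) by fastforce
  have "runs (A @ B) (s, ctr \<sigma>) (e, ctr (f \<sigma>))" if "P \<sigma>" for \<sigma>
    using runs_trans[OF runs_append1[OF A(4)] runs_append2[OF disj B(4)]] *[OF that] by simp
  moreover have "fst ` set (A @ B) \<subseteq> {s..<e}" using A(1,2) B(1,2) by fastforce
  moreover have "closed_in {s..e} (A @ B)"
    using A(1,3) B(1,3) by (fastforce simp: closed_in_def)
  ultimately show "\<exists>L e. s \<le> e \<and> fst ` set L \<subseteq> {s..<e} \<and> closed_in {s..e} L \<and>
      (\<forall>\<sigma>. P \<sigma> \<longrightarrow> runs L (s, ctr \<sigma>) (e, ctr (f \<sigma>)))"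
    using A(1) B(1) by (intro exI[of _ "A @ B"] exI[of _ e]) auto
qed

text \<open>The loop decrements \<open>r\<close> and runs the body until \<open>r\<close> is 0. Here
  \<open>I\<close> is the loop invariant, and the overall effect \<open>f\<close> is characterized
  by being unchanged by one round; the proof is by induction on the value of
  \<open>r\<close>.\<close>

lemma transforms_loop:
  assumes "transforms Q g"
    and I0: "\<And>\<sigma>. I \<sigma> \<Longrightarrow> \<sigma> r = 0 \<Longrightarrow> f \<sigma> = \<sigma>"
    and IS: "\<And>\<sigma> k. I \<sigma> \<Longrightarrow> \<sigma> r = Suc k \<Longrightarrow> Q (\<sigma>(r := k)) \<and> I (g (\<sigma>(r := k))) \<and>
      g (\<sigma>(r := k)) r = k \<and> f (g (\<sigma>(r := k))) = f \<sigma>"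
  shows "transforms I f"
  unfolding transforms_def
proof (intro allI)
  fix s :: nat
  obtain B m where B: "s + 1 \<le> m" "fst ` set B \<subseteq> {s + 1..<m}" "closed_in {s + 1..m} B"
    "\<And>\<sigma>. Q \<sigma> \<Longrightarrow> runs B (s + 1, ctr \<sigma>) (m, ctr (g \<sigma>))"
    using assms(1) unfolding transforms_def by meson
  \<comment> \<open>State \<open>s\<close> exits on 0 and otherwise erases the first 1, moving right
    to decrement. State \<open>m\<close> jumps back unconditionally, which takes one instruction for
    each symbol.\<close>
  define T :: "instruction list" where
    "T = [(s, r, 0, m + 1, 0, No_Move), (s, r, Suc 0, s + 1, 0, Move_Right),
      (m, r, 0, s, 0, No_Move), (m, r, Suc 0, s, 1, No_Move)]"
  define L where "L = T @ B"
  have disj: "fst ` set T \<inter> fst ` set B = {}" using B(1,2) by (fastforce simp: T_def)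
  have stop: "vstep L (s, ctr \<sigma>) = Some (m + 1, ctr \<sigma>)" if "\<sigma> r = 0" for \<sigma>
    unfolding L_def using that
    by (intro vstep_append1) (auto simp: T_def vstep_def ctr_def num_0 vact_No_Move fun_eq_iff)
  have enter: "vstep L (s, ctr \<sigma>) = Some (s + 1, ctr (\<sigma>(r := k)))" if "\<sigma> r = Suc k" for \<sigma> k
    unfolding L_def using that
    by (intro vstep_append1) (auto simp: T_def vstep_def ctr_upd num_0 vact_dec ctr_def[of _ r])
  have again: "vstep L (m, ctr \<sigma>) = Some (s, ctr \<sigma>)" for \<sigma>
    unfolding L_def using B(1)
    by (intro vstep_append1) (auto simp: T_def vstep_def ctr_def num_0 vact_No_Move fun_eq_iff)
  have "runs L (s, ctr \<sigma>) (m + 1, ctr (f \<sigma>))" if "I \<sigma>" for \<sigma>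
    using that
  proof (induction "\<sigma> r" arbitrary: \<sigma>)
    case 0
    then have "f \<sigma> = \<sigma>" using I0[of \<sigma>] by simp
    then show ?case using stop[of \<sigma>] 0 by (simp add: runs_step[OF _ runs_refl])
  next
    case (Suc k)
    have k: "\<sigma> r = Suc k" using Suc.hyps(2) by simp
    note IS' = IS[OF Suc.prems k]
    have "runs L (s + 1, ctr (\<sigma>(r := k))) (m, ctr (g (\<sigma>(r := k))))"
      unfolding L_def using IS' by (intro runs_append2[OF disj B(4)]) simp
    also have "runs L (m, ctr (g (\<sigma>(r := k)))) (m + 1, ctr (f (g (\<sigma>(r := k)))))"
      using IS' by (intro runs_step[OF again] Suc.hyps(1)) simp_all
    finally show ?case using IS' runs_step[OF enter[of \<sigma> k, OF k]] by simp
  qed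
  moreover have "fst ` set L \<subseteq> {s..<m + 1}" using B(1,2) by (fastforce simp: L_def T_def)
  moreover have "closed_in {s..m + 1} L"
    using B(1,3) by (fastforce simp: closed_in_def L_def T_def)
  ultimately show "\<exists>L e. s \<le> e \<and> fst ` set L \<subseteq> {s..<e} \<and> closed_in {s..e} L \<and>
      (\<forall>\<sigma>. I \<sigma> \<longrightarrow> runs L (s, ctr \<sigma>) (e, ctr (f \<sigma>)))"
    using B(1) by (intro exI[of _ L] exI[of _ "m + 1"]) auto
qed

section \<open>Clearing, moving and duplicating counters\<close>

lemma transforms_clear: "transforms (\<lambda>_. True) (\<lambda>\<sigma>. \<sigma>(r := 0))"
  by (rule transforms_loop[OF transforms_skip, of _ r]) (auto simp: fun_eq_iff)

lemma transforms_add: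
  "r \<noteq> t \<Longrightarrow> transforms (\<lambda>_. True) (\<lambda>\<sigma>. \<sigma>(t := \<sigma> t + \<sigma> r, r := 0))"
  by (rule transforms_loop[OF transforms_inc[of t], of _ r]) (auto simp: fun_eq_iff)

lemma transforms_move: "r \<noteq> t \<Longrightarrow> transforms (\<lambda>_. True) (\<lambda>\<sigma>. \<sigma>(t := \<sigma> r, r := 0))"
  by (rule transforms_seq[OF transforms_clear[of t] transforms_add[of r t]])
    (auto simp: fun_eq_iff)

text \<open>A loop reads a counter by emptying it, so a copy is made by filling two counters at
  once; the source is restored from the second one afterwards.\<close>

lemma transforms_dup:
  assumes "r \<noteq> t" "r \<noteq> t'" "t \<noteq> t'"
  shows "transforms (\<lambda>_. True) (\<lambda>\<sigma>. \<sigma>(t := \<sigma> t + \<sigma> r, t' := \<sigma> t' + \<sigma> r, r := 0))"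
proof (rule transforms_loop[where r = r])
  show "transforms (\<lambda>_. True) (\<lambda>\<sigma>. \<sigma>(t := Suc (\<sigma> t), t' := Suc (\<sigma> t')))"
    by (rule transforms_seq[OF transforms_inc[of t] transforms_inc[of t']])
      (use assms in \<open>auto simp: fun_eq_iff\<close>)
qed (use assms in \<open>auto simp: fun_eq_iff\<close>)

section \<open>Arithmetic and primitive recursion with scratch counters\<close>

definition clean_from :: "nat \<Rightarrow> (nat \<Rightarrow> nat) \<Rightarrow> bool" where
  "clean_from n \<sigma> \<longleftrightarrow> (\<forall>i\<ge>n. \<sigma> i = 0)"

text \<open>Counters from \<open>n\<close> on are scratch space, zero before and, except for the result in
  counter \<open>n\<close>, after the computation.\<close>

definition computes_from :: "nat \<Rightarrow> ((nat \<Rightarrow> nat) \<Rightarrow> nat) \<Rightarrow> bool" where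
  "computes_from N h \<longleftrightarrow>
     (\<forall>n\<ge>N. transforms (clean_from n) (\<lambda>\<sigma>. \<sigma>(n := h \<sigma>))) \<and>
     (\<forall>\<sigma> i x. N \<le> i \<longrightarrow> h (\<sigma>(i := x)) = h \<sigma>)"

lemma computes_fromI:
  "(\<And>n. N \<le> n \<Longrightarrow> transforms (clean_from n) (\<lambda>\<sigma>. \<sigma>(n := h \<sigma>))) \<Longrightarrow>
   (\<And>\<sigma> i x. N \<le> i \<Longrightarrow> h (\<sigma>(i := x)) = h \<sigma>) \<Longrightarrow> computes_from N h"
  by (simp add: computes_from_def)

lemma computes_from_upd: "computes_from N h \<Longrightarrow> N \<le> i \<Longrightarrow> h (\<sigma>(i := x)) = h \<sigma>"
  by (simp add: computes_from_def)

lemma computes_fromD: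
  "computes_from N h \<Longrightarrow> N \<le> n \<Longrightarrow> transforms (clean_from n) (\<lambda>\<sigma>. \<sigma>(n := h \<sigma>))"
  by (simp add: computes_from_def)

lemma computes_from_var: "i < N \<Longrightarrow> computes_from N (\<lambda>\<sigma>. \<sigma> i)"
proof (rule computes_fromI)
  fix n assume "i < N" "N \<le> n"
  then show "transforms (clean_from n) (\<lambda>\<sigma>. \<sigma>(n := \<sigma> i))"
    by (intro transforms_seq[OF transforms_dup[of i n "Suc n"] transforms_add[of "Suc n" i]])
      (auto simp: fun_eq_iff clean_from_def)
qed auto

lemma computes_from_Suc: "computes_from N h \<Longrightarrow> computes_from N (\<lambda>\<sigma>. Suc (h \<sigma>))"
proof (rule computes_fromI)
  fix n assume "computes_from N h" "N \<le> n"
  then show "transforms (clean_from n) (\<lambda>\<sigma>. \<sigma>(n := Suc (h \<sigma>)))"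
    by (intro transforms_seq[OF computes_fromD transforms_inc[of n]]) auto
qed (simp add: computes_from_upd)

lemma computes_from_const: "computes_from N (\<lambda>\<sigma>. c)"
proof (induction c)
  case 0
  show ?case
    by (rule computes_fromI[OF transforms_mono[OF transforms_skip]])
      (auto simp: fun_eq_iff clean_from_def)
qed (rule computes_from_Suc)

lemma computes_from_add:
  assumes "computes_from N g" "computes_from N h"
  shows "computes_from N (\<lambda>\<sigma>. g \<sigma> + h \<sigma>)"
proof (rule computes_fromI)
  fix n assume n: "N \<le> n"
  have "transforms (clean_from n) (\<lambda>\<sigma>. \<sigma>(n := g \<sigma>, Suc n := h \<sigma>))"
    by (rule transforms_seq[OF computes_fromD[OF assms(1) n]
          computes_fromD[OF assms(2), of "Suc n"]])
      (use n in \<open>auto simp: computes_from_upd[OF assms(2)] clean_from_def\<close>)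
  then show "transforms (clean_from n) (\<lambda>\<sigma>. \<sigma>(n := g \<sigma> + h \<sigma>))"
    by (rule transforms_seq[OF _ transforms_add[of "Suc n" n]])
      (auto simp: fun_eq_iff clean_from_def)
qed (simp add: computes_from_upd[OF assms(1)] computes_from_upd[OF assms(2)])

text \<open>Counter \<open>n\<close> holds the number of remaining rounds, \<open>n + 1\<close> the
  index of the current round and \<open>n + 2\<close> the accumulated value; the body
  \<open>b\<close> is computed in scratch space from \<open>n + 3\<close> on.\<close>

lemma computes_from_rec:
  assumes k: "computes_from N k" and a: "computes_from N a"
    and b: "\<And>n. N \<le> n \<Longrightarrow> computes_from (n + 3) (\<lambda>\<sigma>. b (\<sigma> (n + 1)) (\<sigma> (n + 2)))"
  shows "computes_from N (\<lambda>\<sigma>. rec_nat (a \<sigma>) b (k \<sigma>))"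
proof (rule computes_fromI)
  fix n assume n: "N \<le> n"
  have a_upd: "a (\<sigma>(i := x)) = a \<sigma>" if "n \<le> i" for \<sigma> i x
    using computes_from_upd[OF a, of i] that n by simp
  have init: "transforms (clean_from n) (\<lambda>\<sigma>. \<sigma>(n := k \<sigma>, n + 2 := a \<sigma>))"
    by (rule transforms_seq[OF computes_fromD[OF k n] computes_fromD[OF a, of "n + 2"]])
      (use n in \<open>auto simp: computes_from_upd[OF a] clean_from_def\<close>)
  have "transforms (clean_from (n + 3)) (\<lambda>\<sigma>. \<sigma>(n + 2 := b (\<sigma> (n + 1)) (\<sigma> (n + 2))))"
    by (rule transforms_seq[OF computes_fromD[OF b[OF n] order_refl]
          transforms_move[of "n + 3" "n + 2"]]) (auto simp: fun_eq_iff clean_from_def)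
  then have body: "transforms (clean_from (n + 3))
      (\<lambda>\<sigma>. \<sigma>(n + 2 := b (\<sigma> (n + 1)) (\<sigma> (n + 2)), n + 1 := Suc (\<sigma> (n + 1))))"
    by (rule transforms_seq[OF _ transforms_inc[of "n + 1"]]) auto
  \<comment> \<open>The invariant says that the accumulator is the value of the recursion at the
    current index. The sum of remaining rounds and index is constant, and at the end it is the
    index.\<close>
  have "transforms (\<lambda>\<sigma>. clean_from (n + 3) \<sigma> \<and> \<sigma> (n + 2) = rec_nat (a \<sigma>) b (\<sigma> (n + 1)))
      (\<lambda>\<sigma>. \<sigma>(n := 0, n + 1 := \<sigma> n + \<sigma> (n + 1), n + 2 := rec_nat (a \<sigma>) b (\<sigma> n + \<sigma> (n + 1))))"
    by (rule transforms_loop[OF body, where r = n]) (auto simp: fun_eq_iff clean_from_def a_upd)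
  then have "transforms (clean_from n) (\<lambda>\<sigma>. \<sigma>(n + 1 := k \<sigma>, n + 2 := rec_nat (a \<sigma>) b (k \<sigma>)))"
    by (rule transforms_seq[OF init]) (auto simp: fun_eq_iff clean_from_def a_upd)
  then have "transforms (clean_from n) (\<lambda>\<sigma>. \<sigma>(n + 2 := rec_nat (a \<sigma>) b (k \<sigma>)))"
    by (rule transforms_seq[OF _ transforms_clear[of "n + 1"]])
      (auto simp: fun_eq_iff clean_from_def)
  then show "transforms (clean_from n) (\<lambda>\<sigma>. \<sigma>(n := rec_nat (a \<sigma>) b (k \<sigma>)))"
    by (rule transforms_seq[OF _ transforms_move[of "n + 2" n]])
      (auto simp: fun_eq_iff clean_from_def)
qed (simp add: computes_from_upd[OF k] computes_from_upd[OF a])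

text \<open>The pairing function maps \<open>(m, n)\<close> to \<open>triangle (m + n) + m\<close>,
  so this recursion makes it computable.\<close>

lemma triangle_eq_rec_nat: "triangle n = rec_nat 0 (\<lambda>j a. a + Suc j) n"
  by (induction n) auto

lemma computes_from_prod_encode:
  assumes "computes_from N g" "computes_from N h"
  shows "computes_from N (\<lambda>\<sigma>. prod_encode (g \<sigma>, h \<sigma>))"
  unfolding prod_encode_def prod.case triangle_eq_rec_nat
  by (intro computes_from_add computes_from_rec computes_from_const computes_from_Suc assms
      computes_from_var) auto

lemma computableI:
  assumes "computes_from 1 (\<lambda>\<sigma>. f (\<sigma> 0))"
  shows "computable f"
proof -
  have "transforms (clean_from 1) (\<lambda>\<sigma>. \<sigma>(0 := f (\<sigma> 0)))"
    by (rule transforms_seq[OF computes_fromD[OF assms order_refl] transforms_move[of 1 0]])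
      (auto simp: fun_eq_iff clean_from_def)
  then obtain L e where L: "fst ` set L \<subseteq> {0..<e}"
    "\<And>\<sigma>. clean_from 1 \<sigma> \<Longrightarrow> runs L (0, ctr \<sigma>) (e, ctr (\<sigma>(0 := f (\<sigma> 0))))"
    unfolding transforms_def by meson
  have "outputs (0, L) [n] (f n)" for n
  proof -
    have "runs L (0, ctr (regs [n])) (e, ctr ((regs [n])(0 := f n)))"
      using L(2)[of "regs [n]"] by (simp add: clean_from_def regs_def)
    moreover have "vstep L (e, ctr ((regs [n])(0 := f n))) = None"
      using L(1) by (intro vstep_None) auto
    ultimately show ?thesis
      unfolding outputs_iff_results results_def
      by (intro exI[of _ e] exI[of _ "ctr ((regs [n])(0 := f n))"]) (auto simp: ctr_def num_def)
  qed
  then show ?thesis unfolding computable_def by blast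
qed

section \<open>The enumerating machines\<close>

text \<open>Entered in state \<open>b + n\<close>, it writes \<open>n\<close> ones leftwards and
  leaves in state \<open>b\<close> with the head to their left. The order is reversed so that the
  list for \<open>Suc n\<close> arises from that for \<open>n\<close> by adding one instruction in
  front.\<close>

definition block :: "nat \<Rightarrow> nat \<Rightarrow> nat \<Rightarrow> instruction list" where
  "block t b n = map (\<lambda>j. (b + j + 1, t, 0, b + j, 1, Move_Left)) (rev [0..<n])"

lemma block_0 [simp]: "block t b 0 = []"
  by (simp add: block_def)

lemma block_Suc [simp]: "block t b (Suc n) = (b + n + 1, t, 0, b + n, 1, Move_Left) # block t b n"
  by (simp add: block_def)

lemma sources_block: "fst ` set (block t b n) \<subseteq> {b<..b + n}"
  by (auto simp: block_def)

lemma closed_in_block: "closed_in {b..b + n} (block t b n)"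
  by (auto simp: closed_in_def block_def)

lemma runs_block: "runs (block t b n) (b + n, V(t := lnum j)) (b, V(t := lnum (j + n)))"
proof (induction n arbitrary: j)
  case (Suc n)
  have "vstep (block t b (Suc n)) (b + Suc n, V(t := lnum j)) =
      Some (b + n, V(t := lnum (Suc j)))"
    using vact_lnum_write[of j] by (simp add: vstep_def)
  moreover have "runs (block t b (Suc n)) (b + n, V(t := lnum (Suc j))) (b, V(t := lnum (Suc j + n)))"
  proof -
    have "runs ([(b + n + 1, t, 0, b + n, 1, Move_Left)] @ block t b n)
        (b + n, V(t := lnum (Suc j))) (b, V(t := lnum (Suc j + n)))"
      by (rule runs_append2[OF _ Suc.IH]) (use sources_block[of t b n] in auto)
    then show ?thesis by simp
  qed
  ultimately show ?case using runs_step by (metis add_Suc add_Suc_right)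
qed simp

text \<open>The machines combined below are entered with parameter \<open>n\<close> on tape 1 and input \<open>k\<close> on
  tape 2, so that \<open>n, k\<close> are in place for a machine whose tape \<open>i\<close> is moved to \<open>i + 1\<close>.\<close>

definition semidecides :: "(nat \<Rightarrow> nat \<Rightarrow> nat \<Rightarrow> bool) \<Rightarrow> bool" where
  "semidecides P \<longleftrightarrow>
     (\<forall>s. \<exists>L p e. s \<le> p \<and> p < e \<and> closed_in {s..<e} L \<and>
        (\<forall>n k y. results L (p, ctr (regs [0, n, k])) y \<longleftrightarrow> P n k y))"

lemma num_eq_iff: "(\<forall>i<y. num c (int i) = 1) \<and> num c (int y) = 0 \<longleftrightarrow> y = c"
proof
  assume *: "(\<forall>i<y. num c (int i) = 1) \<and> num c (int y) = 0"
  then have "\<not> c < y" by (auto simp: num_def dest: spec[of _ c])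
  moreover have "\<not> y < c" using * by (auto simp: num_def)
  ultimately show "y = c" by simp
qed (simp add: num_def)

text \<open>The input is moved from tape 2 to tape 0 and the parameter on tape 1 is erased, which
  gives exactly the initial tapes of \<open>M\<close>; then a relocated copy of \<open>M\<close>
  takes over.\<close>

lemma semidecides_outputs: "semidecides (\<lambda>n k y. outputs M [k] y)"
  unfolding semidecides_def
proof (intro allI)
  fix s
  have "transforms (\<lambda>\<sigma>. \<sigma> 0 = 0) (\<lambda>\<sigma>. \<sigma>(0 := \<sigma> 2, 2 := 0, 1 := 0))"
    by (rule transforms_seq[OF transforms_move[of 2 0] transforms_clear[of 1]]) auto
  then obtain A m where A: "s \<le> m" "fst ` set A \<subseteq> {s..<m}" "closed_in {s..m} A"
    "\<And>\<sigma>. \<sigma> 0 = 0 \<Longrightarrow> runs A (s, ctr \<sigma>) (m, ctr (\<sigma>(0 := \<sigma> 2, 2 := 0, 1 := 0)))"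
    unfolding transforms_def by meson
  obtain q L where M: "M = (q, L)" by (cases M)
  obtain N where N: "closed_in {..<N} L" "q < N" using states_bounded by blast
  define e where "e = m + 1 + N"
  define K where "K = relocate id (m + 1) L"
  \<comment> \<open>A jump from the exit of the preparation to the relocated start state. It tests
    tape 1, which has just been cleared.\<close>
  define J :: "instruction list" where "J = [(m, 1, 0, q + (m + 1), 0, No_Move)]"
  have K: "closed_in {m + 1..<e} K"
    unfolding K_def e_def by (rule closed_in_relocate[OF N(1)])
  have AJ: "fst ` set (A @ J) \<subseteq> {s..<m + 1}" using A(1,2) by (fastforce simp: J_def)
  have "results (A @ J @ K) (s, ctr (regs [0, n, k])) y \<longleftrightarrow> outputs M [k] y" for n k y
  proof -
    have "(regs [0, n, k])(0 := k, 2 := 0, 1 := 0) = regs [k]"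
      by (auto simp: regs_def fun_eq_iff nth_Cons' less_Suc_eq)
    then have "runs (A @ J @ K) (s, ctr (regs [0, n, k])) (m, ctr (regs [k]))"
      using A(4)[of "regs [0, n, k]"] by (intro runs_append1) (simp add: regs_def)
    moreover have "vstep (A @ J @ K) (m, ctr (regs [k])) = Some (q + (m + 1), ctr (regs [k]))"
    proof -
      have "vstep J (m, ctr (regs [k])) = Some (q + (m + 1), ctr (regs [k]))"
        by (auto simp: vstep_def J_def ctr_def regs_def num_0 vact_No_Move fun_eq_iff num_def)
      moreover have "m \<notin> fst ` set A" using A(2) by auto
      ultimately show ?thesis by (simp add: vstep_append2 vstep_append1)
    qed
    ultimately have "runs (A @ J @ K) (s, ctr (regs [0, n, k])) (q + (m + 1), ctr (regs [k]))"
      by (meson runs_refl runs_step runs_trans)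
    from results_cong_runs[OF this]
    have "results (A @ J @ K) (s, ctr (regs [0, n, k])) y \<longleftrightarrow>
        results ((A @ J) @ K @ []) (q + (m + 1), ctr (regs [k])) y" by simp
    also have "\<dots> \<longleftrightarrow> results K (q + (m + 1), ctr (regs [k])) y"
      by (rule results_embed[OF K]) (use AJ N(2) in \<open>auto simp: e_def\<close>)
    also have "\<dots> \<longleftrightarrow> outputs M [k] y"
      unfolding K_def results_relocate_id by (simp add: outputs_iff_results M)
    finally show ?thesis .
  qed
  moreover have "closed_in {s..<e} (A @ J @ K)"
    using A(1,3) K N(2) by (fastforce simp: closed_in_def J_def e_def)
  ultimately show "\<exists>L p e. s \<le> p \<and> p < e \<and> closed_in {s..<e} L \<and>
      (\<forall>n k y. results L (p, ctr (regs [0, n, k])) y \<longleftrightarrow> outputs M [k] y)"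
    using A(1) by (intro exI[of _ "A @ J @ K"] exI[of _ s] exI[of _ e]) (auto simp: e_def)
qed

text \<open>The rejecting branch writes 2 on tape 0, so that it has no result.\<close>

lemma semidecides_decidable2:
  assumes "decidable2 R"
  shows "semidecides (\<lambda>n k y. R n k \<and> y = c)"
  unfolding semidecides_def
proof (intro allI)
  fix s :: nat
  obtain M where M: "\<And>n k. outputs M [n, k] (of_bool (R n k))"
    using assms unfolding decidable2_def by blast
  obtain q L where qL: "M = (q, L)" by (cases M)
  obtain N where N: "closed_in {..<N} L" "q < N" using states_bounded by blast
  \<comment> \<open>State \<open>s\<close> is the halting state, \<open>s + 1\<close> rejects,
    \<open>s + 2\<close> to \<open>s + 2 + c\<close> write the result \<open>c\<close>,
    \<open>x\<close> inspects the answer, and the states from \<open>d\<close> on belong to the copy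
    of \<open>M\<close>.\<close>
  define x where "x = s + 3 + c"
  define d where "d = x + 1"
  define e where "e = d + N"
  define G :: "instruction list" where
    "G = [(s + 1, 0, 0, s, 2, No_Move), (s + 2, 0, 0, s, 0, Move_Right),
      (x, 1, 0, s + 1, 0, No_Move), (x, 1, 1, s + 2 + c, 1, No_Move)]"
  \<comment> \<open>Shifting the tapes by one keeps tape 0 blank for the result; the answer of
    \<open>M\<close> appears on tape 1.\<close>
  define K where "K = relocate Suc d L"
  \<comment> \<open>A jump to \<open>x\<close> from every state of the copy. It stands after
    \<open>K\<close>, so it acts only once the copy has halted; it tests tape 0, which the copy
    leaves blank.\<close>
  define H where "H = map (\<lambda>p. (p, 0, 0, x, 0, No_Move) :: instruction) [d..<e]"
  define P where "P = (G @ block 0 (s + 2) c) @ K @ H"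
  have K: "closed_in {d..<e} K"
    unfolding K_def e_def by (rule closed_in_relocate[OF N(1)])
  have Gb: "fst ` set (G @ block 0 (s + 2) c) \<subseteq> {s..<d}"
    using sources_block[of 0 "s + 2" c] by (fastforce simp: G_def d_def x_def)
  have KH: "fst ` set (K @ H) \<subseteq> {d..<e}"
    using closed_in_sources[OF K] by (auto simp: H_def)
  have disj: "fst ` set (G @ block 0 (s + 2) c) \<inter> fst ` set (K @ H) = {}"
    using Gb KH by fastforce
  have "closed_in {s..<e} P"
    using K closed_in_block[of "s + 2" c 0] N(2)
    by (fastforce simp: closed_in_def P_def G_def H_def d_def e_def x_def)
  moreover have "results P (q + d, ctr (regs [0, n, k])) y \<longleftrightarrow> R n k \<and> y = c" for n k y
  proof -
    obtain q' V where V: "runs L (q, ctr (regs [n, k])) (q', V)" "vstep L (q', V) = None"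
      "\<forall>i<of_bool (R n k) :: nat. V 0 (int i) = 1" "V 0 (int (of_bool (R n k))) = 0"
      using M[of n k] unfolding outputs_iff_results qL results_def by auto
    \<comment> \<open>Inserts a blank tape in front of the tapes of \<open>M\<close>, matching the
      shift \<open>Suc\<close>.\<close>
    define E where "E = (\<lambda>U. case_nat (num 0) U :: nat \<Rightarrow> int \<Rightarrow> nat)"
    have E: "E U (Suc i) = U i" "(E U)(Suc i := v) = E (U(i := v))" for U i v
      by (auto simp: E_def fun_eq_iff split: nat.split)
    have E0: "E U 0 = num 0" for U by (simp add: E_def)
    have E_regs: "E (ctr (regs [n, k])) = ctr (regs [0, n, k])"
      by (auto simp: E_def ctr_def regs_def fun_eq_iff split: nat.split)
    have "q' < N"
    proof -
      have "fst c' < N" if "runs L (q, U) c'" for U c'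
        using that unfolding runs_def
        by induction (use N vstep_closed_in[OF N(1)] in auto)
      then show ?thesis using V(1) by fastforce
    qed
    have run1: "runs P (q + d, ctr (regs [0, n, k])) (q' + d, E V)"
      unfolding P_def using runs_relocate[of E Suc L _ _ d, OF E V(1)]
      by (intro runs_append2[OF disj] runs_append1) (simp add: K_def E_regs)
    have "vstep K (q' + d, E V) = None"
      using vstep_relocate[of E Suc d L q' V, OF E] V(2) by (simp add: K_def)
    then have "vstep (K @ H) (q' + d, E V) = vstep H (q' + d, E V)"
      by (auto simp: vstep_def find_append)
    also have "\<dots> = Some (x, E V)"
    proof -
      have "find (\<lambda>(p, i, a, p', b, m). p = q' + d \<and> a = E V i 0) H
          = Some (q' + d, 0, 0, x, 0, No_Move)"
      proof -
        have "find (\<lambda>(p, i, a, p', b, m). p = r \<and> a = E V i 0)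
            (map (\<lambda>p. (p, 0, 0, x, 0, No_Move) :: instruction) ps) = Some (r, 0, 0, x, 0, No_Move)"
          if "r \<in> set ps" for ps r
          using that by (induction ps) (auto simp: E0 num_0)
        then show ?thesis using \<open>q' < N\<close> by (simp add: H_def e_def)
      qed
      then show ?thesis
        by (auto simp: vstep_def vact_No_Move E0 num_0 fun_eq_iff num_def)
    qed
    finally have "vstep P (q' + d, E V) = Some (x, E V)"
      unfolding P_def using Gb by (subst vstep_append2) auto
    then have run2: "runs P (q + d, ctr (regs [0, n, k])) (x, E V)"
      using run1 by (meson runs_refl runs_step runs_trans)
    have G: "vstep P u = Some u'" if "vstep G u = Some u'" for u u'
      unfolding P_def by (intro vstep_append1 that)
    have halt: "vstep P (s, U) = None" for U
    proof (rule vstep_None)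
      show "fst (s, U) \<notin> fst ` set P"
        using KH sources_block[of 0 "s + 2" c] by (fastforce simp: P_def G_def d_def x_def)
    qed
    show ?thesis
    proof (cases "R n k")
      case True
      then have "V 0 0 = 1" using V(3) by auto
      then have "vstep P (x, E V) = Some (s + 2 + c, E V)"
        using E(1)[of V 0]
        by (intro G) (auto simp: vstep_def G_def x_def vact_No_Move fun_eq_iff)
      moreover have "runs P (s + 2 + c, E V) (s + 2, (E V)(0 := lnum c))"
      proof -
        have "E V = (E V)(0 := lnum 0)" by (auto simp: E0 lnum_of_0 fun_eq_iff)
        then have "runs (block 0 (s + 2) c) (s + 2 + c, E V) (s + 2, (E V)(0 := lnum c))"
          using runs_block[of 0 "s + 2" c "E V" 0] by simp
        then show ?thesis
          unfolding P_def append_assoc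
          by (intro runs_append2 runs_append1)
            (use sources_block[of 0 "s + 2" c] KH in \<open>auto simp: G_def x_def d_def\<close>)
      qed
      \<comment> \<open>The final move right puts the head on the first written 1, as the output
        convention demands; for \<open>c = 0\<close> it lands on a blank.\<close>
      moreover have "vstep P (s + 2, (E V)(0 := lnum c)) = Some (s, (E V)(0 := num c))"
        by (intro G) (auto simp: vstep_def G_def x_def vact_lnum_right)
      ultimately have "runs P (q + d, ctr (regs [0, n, k])) (s, (E V)(0 := num c))"
        using run2 by (meson runs_refl runs_step runs_trans)
      then have "results P (q + d, ctr (regs [0, n, k])) y \<longleftrightarrow> results P (s, (E V)(0 := num c)) y"
        by (rule results_cong_runs)
      also have "\<dots> \<longleftrightarrow> y = c"
      proof -
        have stuck: "runs P (s, U) u \<longleftrightarrow> u = (s, U)" for U u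
          unfolding runs_def using halt[of U] by (auto elim: converse_rtranclpE)
        have "(\<forall>i<y. num c (int i) = 1) \<and> num c (int y) = 0 \<longleftrightarrow> y = c"
          by (rule num_eq_iff)
        then show ?thesis
          unfolding results_def stuck using halt by auto
      qed
      finally show ?thesis using True by simp
    next
      case False
      then have "V 0 0 = 0" using V(4) by simp
      then have "vstep P (x, E V) = Some (s + 1, E V)"
        using E(1)[of V 0]
        by (intro G) (auto simp: vstep_def G_def x_def vact_No_Move fun_eq_iff)
      moreover have "vstep P (s + 1, E V) = Some (s, (E V)(0 := (num 0)(0 := 2)))"
        by (intro G) (auto simp: vstep_def G_def x_def vact_No_Move E0 num_0)
      ultimately have "runs P (q + d, ctr (regs [0, n, k])) (s, (E V)(0 := (num 0)(0 := 2)))"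
        using run2 by (meson runs_refl runs_step runs_trans)
      then have "results P (q + d, ctr (regs [0, n, k])) y \<longleftrightarrow>
          results P (s, (E V)(0 := (num 0)(0 := 2))) y"
        by (rule results_cong_runs)
      also have "\<dots> \<longleftrightarrow> False"
      proof -
        have stuck: "runs P (s, U) u \<longleftrightarrow> u = (s, U)" for U u
          unfolding runs_def using halt[of U] by (auto elim: converse_rtranclpE)
        show ?thesis unfolding results_def stuck by (cases y) auto
      qed
      finally show ?thesis using False by simp
    qed
  qed
  ultimately show "\<exists>L p e. s \<le> p \<and> p < e \<and> closed_in {s..<e} L \<and>
      (\<forall>n k y. results L (p, ctr (regs [0, n, k])) y \<longleftrightarrow> R n k \<and> y = c)"
    using N(2) by (intro exI[of _ P] exI[of _ "q + d"] exI[of _ e]) (auto simp: d_def x_def e_def)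
qed

text \<open>States 0 to 3 divide tape 0 by 3, with the quotient on tape 2; states 4 to 6 continue
  according to the remainder.\<close>

definition branch3 :: "nat \<Rightarrow> nat \<Rightarrow> nat \<Rightarrow> instruction list" where
  "branch3 p0 p1 p2 =
    [(0, 0, 0, 4, 0, No_Move), (0, 0, 1, 1, 0, Move_Right),
     (1, 0, 0, 5, 0, No_Move), (1, 0, 1, 2, 0, Move_Right),
     (2, 0, 0, 6, 0, No_Move), (2, 0, 1, 3, 0, Move_Right),
     (3, 2, 0, 0, 1, Move_Left),
     (4, 2, 0, p0, 0, Move_Right), (5, 2, 0, p1, 0, Move_Right), (6, 2, 0, p2, 0, Move_Right)]"

text \<open>Strong induction in steps of three, with the quotient so far as accumulator
  \<open>j\<close>. The head of tape 2 stays left of the ones until the exit, whose move right turns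
  \<open>lnum\<close> into \<open>num\<close>.\<close>

lemma runs_branch3:
  fixes V :: "nat \<Rightarrow> int \<Rightarrow> nat"
  shows "runs (branch3 p0 p1 p2) (0, V(0 := num k, 2 := lnum j))
    ([p0, p1, p2] ! (k mod 3), V(0 := num 0, 2 := num (j + k div 3)))"
proof (induction k arbitrary: j rule: less_induct)
  case (less k)
  let ?L = "branch3 p0 p1 p2"
  let ?W = "\<lambda>k j. V(0 := num k, 2 := lnum j)"
  have stop: "vstep ?L (i, ?W 0 j) = Some (4 + i, ?W 0 j)" if "i < 3" for i
    using that by (auto simp: branch3_def vstep_def num_0 vact_No_Move less_Suc_eq numeral_3_eq_3
        fun_eq_iff num_def)
  have jump: "vstep ?L (4 + i, ?W 0 j) = Some ([p0, p1, p2] ! i, V(0 := num 0, 2 := num j))"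
    if "i < 3" for i
    using that
    by (auto simp: branch3_def vstep_def vact_lnum_right less_Suc_eq numeral_3_eq_3 fun_eq_iff)
  have dec: "vstep ?L (i, ?W (Suc k) j) = Some (i + 1, ?W k j)" if "i < 3" for i k
    using that by (auto simp: branch3_def vstep_def num_0 vact_dec less_Suc_eq numeral_3_eq_3
        fun_eq_iff)
  have again: "vstep ?L (3, ?W k j) = Some (0, ?W k (Suc j))" for k
    using vact_lnum_write[of j] by (simp add: branch3_def vstep_def)
  show ?case
  proof (cases "k < 3")
    case True
    then consider "k = 0" | "k = Suc 0" | "k = Suc (Suc 0)" by linarith
    then have "runs ?L (0, ?W k j) (k, ?W 0 j)"
    proof cases
      case 2
      then show ?thesis using runs_step[OF dec[of 0 0] runs_refl] by simp
    next
      case 3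
      have "vstep ?L (0, ?W k j) = Some (1, ?W 1 j)" "vstep ?L (1, ?W 1 j) = Some (k, ?W 0 j)"
        using dec[of 0 1] dec[of 1 0] 3 by (simp_all add: numeral_2_eq_2)
      then show ?thesis by (rule runs_step[OF _ runs_step[OF _ runs_refl]])
    qed simp
    also have "runs ?L (k, ?W 0 j) ([p0, p1, p2] ! k, V(0 := num 0, 2 := num j))"
      using stop[OF True] jump[OF True] runs_step runs_refl by blast
    finally have "runs ?L (0, ?W k j) ([p0, p1, p2] ! k, V(0 := num 0, 2 := num j))" .
    moreover have "k mod 3 = k" "j + k div 3 = j" using True by auto
    ultimately show ?thesis by (simp only:)
  next
    case False
    define l where "l = k - 3"
    have l: "k = Suc (Suc (Suc l))" using False by (simp add: l_def)
    have "vstep ?L (0, ?W k j) = Some (1, ?W (Suc (Suc l)) j)"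
      using dec[of 0 "Suc (Suc l)"] by (simp add: l)
    moreover have "vstep ?L (1, ?W (Suc (Suc l)) j) = Some (2, ?W (Suc l) j)"
      using dec[of 1 "Suc l"] by (simp add: numeral_2_eq_2)
    moreover have "vstep ?L (2, ?W (Suc l) j) = Some (3, ?W l j)"
      using dec[of 2 l] by simp
    ultimately have "runs ?L (0, ?W k j) (0, ?W l (Suc j))"
      by (intro runs_step[OF _ runs_step[OF _ runs_step[OF _ runs_step[OF again runs_refl]]]])
    also have "runs ?L (0, ?W l (Suc j))
        ([p0, p1, p2] ! (l mod 3), V(0 := num 0, 2 := num (Suc j + l div 3)))"
      by (rule less) (simp add: l)
    finally have "runs ?L (0, ?W k j)
        ([p0, p1, p2] ! (l mod 3), V(0 := num 0, 2 := num (Suc j + l div 3)))" .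
    moreover have "k = l + 3" by (simp add: l)
    then have "l mod 3 = k mod 3" "Suc j + l div 3 = j + k div 3" by simp_all
    ultimately show ?thesis by (simp only:)
  qed
qed

lemma disjoint_subset: "A \<subseteq> B \<Longrightarrow> B \<inter> S = {} \<Longrightarrow> A \<inter> S = {}"
  by blast

lemma sources_append_disjoint:
  "fst ` set (A @ B) \<inter> S = {} \<longleftrightarrow> fst ` set A \<inter> S = {} \<and> fst ` set B \<inter> S = {}"
  by (simp add: image_Un Int_Un_distrib2)

text \<open>On input \<open>3 * k + i\<close> the machine runs the \<open>i\<close>-th component on
  \<open>k\<close>. The instructions writing the parameter use states above \<open>b\<close>, beyond
  those of all fixed parts, so \<open>L\<close> does not depend on \<open>n\<close>.\<close>

lemma enumerating_machines:
  assumes "semidecides P0" "semidecides P1" "semidecides P2"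
  shows "\<exists>b L. \<forall>n. enumerated_set (b + n, block 1 b n @ L) =
           {y. \<exists>k. P0 n k y \<or> P1 n k y \<or> P2 n k y}"
proof -
  obtain L0 p0 e0 where 0: "7 \<le> p0" "p0 < e0" "closed_in {7..<e0} L0"
    "\<And>n k y. results L0 (p0, ctr (regs [0, n, k])) y \<longleftrightarrow> P0 n k y"
    using assms(1) unfolding semidecides_def by meson
  obtain L1 p1 e1 where 1: "e0 \<le> p1" "p1 < e1" "closed_in {e0..<e1} L1"
    "\<And>n k y. results L1 (p1, ctr (regs [0, n, k])) y \<longleftrightarrow> P1 n k y"
    using assms(2) unfolding semidecides_def by meson
  obtain L2 p2 b where 2: "e1 \<le> p2" "p2 < b" "closed_in {e1..<b} L2"
    "\<And>n k y. results L2 (p2, ctr (regs [0, n, k])) y \<longleftrightarrow> P2 n k y"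
    using assms(3) unfolding semidecides_def by meson
  define D where "D = branch3 p0 p1 p2"
  \<comment> \<open>After the block has written the parameter, its head is one cell too far left;
    this move corrects it and starts the division in state 0.\<close>
  define C :: "instruction list" where "C = [(b, 1, 0, 0, 0, Move_Right)]"
  define L where "L = C @ D @ L0 @ L1 @ L2"
  have src: "fst ` set C \<subseteq> {b}" "fst ` set D \<subseteq> {..<7}" "fst ` set L0 \<subseteq> {7..<e0}"
    "fst ` set L1 \<subseteq> {e0..<e1}" "fst ` set L2 \<subseteq> {e1..<b}"
    using closed_in_sources 0(3) 1(3) 2(3) by (auto simp: C_def D_def branch3_def)
  have le: "7 < e0" "e0 < e1" "e1 < b" using 0(1,2) 1(1,2) 2(1,2) by linarith+
  note disj = src[THEN disjoint_subset]
  have "outputs (b + n, block 1 b n @ L) [k] y \<longleftrightarrow>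
      ([P0, P1, P2] ! (k mod 3)) n (k div 3) y" for n k y
  proof -
    let ?M = "block 1 b n @ L"
    let ?V = "ctr (regs [k])"
    note disj = disj sources_block[of 1 b n, THEN disjoint_subset]
    have b: "b \<notin> fst ` set (block 1 b n)" using sources_block[of 1 b n] by auto
    have "runs ?M (b + n, ?V) (b, ?V(1 := lnum n))"
    proof (rule runs_append1)
      have "?V(1 := lnum 0) = ?V" by (auto simp: ctr_def regs_def lnum_of_0 fun_eq_iff)
      then show "runs (block 1 b n) (b + n, ?V) (b, ?V(1 := lnum n))"
        using runs_block[of 1 b n ?V 0] by (simp only: add_0)
    qed
    also have "runs ?M (b, ?V(1 := lnum n)) (0, ?V(1 := num n))"
    proof (rule runs_step[OF _ runs_refl])
      have "vstep C (b, ?V(1 := lnum n)) = Some (0, ?V(1 := num n))"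
        by (simp add: vstep_def C_def vact_lnum_right)
      then have "vstep L (b, ?V(1 := lnum n)) = Some (0, ?V(1 := num n))"
        unfolding L_def by (rule vstep_append1)
      then show "vstep ?M (b, ?V(1 := lnum n)) = Some (0, ?V(1 := num n))"
        using vstep_append2[of "(b, ?V(1 := lnum n))" "block 1 b n" L] b
        by (simp only: fst_conv not_False_eq_True simp_thms)
    qed
    also have "runs ?M (0, ?V(1 := num n))
        ([p0, p1, p2] ! (k mod 3), ctr (regs [0, n, k div 3]))"
    proof -
      let ?W = "?V(1 := num n)"
      have "?W(0 := num k, 2 := lnum 0) = ?W"
        by (auto simp: ctr_def regs_def lnum_of_0 fun_eq_iff)
      moreover have "?W(0 := num 0, 2 := num (k div 3)) = ctr (regs [0, n, k div 3])"
        by (auto simp: ctr_def regs_def fun_eq_iff nth_Cons' less_Suc_eq)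
      ultimately have "runs D (0, ?W) ([p0, p1, p2] ! (k mod 3), ctr (regs [0, n, k div 3]))"
        using runs_branch3[of p0 p1 p2 ?W k 0] by (simp only: D_def add_0)
      then have "runs (D @ L0 @ L1 @ L2) (0, ?W)
          ([p0, p1, p2] ! (k mod 3), ctr (regs [0, n, k div 3]))"
        by (rule runs_append1)
      then have "runs ((block 1 b n @ C) @ D @ L0 @ L1 @ L2) (0, ?W)
          ([p0, p1, p2] ! (k mod 3), ctr (regs [0, n, k div 3]))"
      proof (rule runs_append2[rotated])
        have "fst ` set (D @ L0 @ L1 @ L2) \<subseteq> {..<b}"
          unfolding set_append image_Un
          by (intro Un_least order_trans[OF src(2)] order_trans[OF src(3)]
              order_trans[OF src(4)] order_trans[OF src(5)]) (use le in auto)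
        moreover have "fst ` set (block 1 b n @ C) \<inter> {..<b} = {}"
          unfolding sources_append_disjoint by (intro conjI disj(1,6)) auto
        ultimately show "fst ` set (block 1 b n @ C) \<inter> fst ` set (D @ L0 @ L1 @ L2) = {}"
          by blast
      qed
      then show ?thesis by (simp only: L_def append_assoc)
    qed
    finally have "outputs (b + n, ?M) [k] y \<longleftrightarrow>
        results ?M ([p0, p1, p2] ! (k mod 3), ctr (regs [0, n, k div 3])) y"
      unfolding outputs_iff_results fst_conv snd_conv by (rule results_cong_runs)
    also have "\<dots> \<longleftrightarrow> ([P0, P1, P2] ! (k mod 3)) n (k div 3) y"
    proof -
      have "results ((block 1 b n @ C @ D) @ L0 @ (L1 @ L2)) (p0, U) y \<longleftrightarrow>
          results L0 (p0, U) y" for U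
      proof (rule results_embed[OF 0(3)])
        show "fst ` set (block 1 b n @ C @ D) \<inter> {7..<e0} = {}"
          unfolding sources_append_disjoint by (intro conjI disj; use le in auto)
        show "fst ` set (L1 @ L2) \<inter> {7..<e0} = {}"
          unfolding sources_append_disjoint by (intro conjI disj; use le in auto)
      qed (use 0(1,2) in simp)
      moreover have "results ((block 1 b n @ C @ D @ L0) @ L1 @ L2) (p1, U) y \<longleftrightarrow>
          results L1 (p1, U) y" for U
      proof (rule results_embed[OF 1(3)])
        show "fst ` set (block 1 b n @ C @ D @ L0) \<inter> {e0..<e1} = {}"
          unfolding sources_append_disjoint by (intro conjI disj; use le in auto)
        show "fst ` set (L2) \<inter> {e0..<e1} = {}"
          by (rule disj) auto
      qed (use 1(1,2) in simp)
      moreover have "results ((block 1 b n @ C @ D @ L0 @ L1) @ L2 @ []) (p2, U) y \<longleftrightarrow>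
          results L2 (p2, U) y" for U
      proof (rule results_embed[OF 2(3)])
        show "fst ` set (block 1 b n @ C @ D @ L0 @ L1) \<inter> {e1..<b} = {}"
          unfolding sources_append_disjoint by (intro conjI disj; use le in auto)
        show "fst ` set ([]) \<inter> {e1..<b} = {}"
          by simp
      qed (use 2(1,2) in simp)
      moreover have "k mod 3 = 0 \<or> k mod 3 = 1 \<or> k mod 3 = 2" by linarith
      ultimately show ?thesis
        unfolding L_def append_assoc append_Nil2 using 0(4) 1(4) 2(4) by (elim disjE) simp_all
    qed
    finally show ?thesis .
  qed
  then have *: "enumerated_set (b + n, block 1 b n @ L) =
      {y. \<exists>k. ([P0, P1, P2] ! (k mod 3)) n (k div 3) y}" for n
    by (simp add: enumerated_set_def)
  have "(\<exists>k. ([P0, P1, P2] ! (k mod 3)) n (k div 3) y) \<longleftrightarrow>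
      (\<exists>k. P0 n k y \<or> P1 n k y \<or> P2 n k y)" for n y
  proof
    assume "\<exists>k. ([P0, P1, P2] ! (k mod 3)) n (k div 3) y"
    then obtain k where "([P0, P1, P2] ! (k mod 3)) n (k div 3) y" by blast
    moreover have "k mod 3 = 0 \<or> k mod 3 = 1 \<or> k mod 3 = 2" by linarith
    ultimately show "\<exists>k. P0 n k y \<or> P1 n k y \<or> P2 n k y" by auto
  next
    assume "\<exists>k. P0 n k y \<or> P1 n k y \<or> P2 n k y"
    then obtain k where "P0 n k y \<or> P1 n k y \<or> P2 n k y" ..
    then show "\<exists>k. ([P0, P1, P2] ! (k mod 3)) n (k div 3) y"
    proof (elim disjE)
      assume "P0 n k y"
      then show ?thesis by (intro exI[of _ "3 * k"]) simp
    next
      assume "P1 n k y"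
      moreover have "(3 * k + 1) mod 3 = 1" "(3 * k + 1) div 3 = k" by presburger+
      ultimately show ?thesis by (metis nth_Cons_0 nth_Cons_Suc One_nat_def numeral_2_eq_2)
    next
      assume "P2 n k y"
      moreover have "(3 * k + 2) mod 3 = 2" "(3 * k + 2) div 3 = k" by presburger+
      ultimately show ?thesis by (metis nth_Cons_0 nth_Cons_Suc One_nat_def numeral_2_eq_2)
    qed
  qed
  with * show ?thesis by auto
qed

section \<open>Computability of the machine code as a function of the parameter\<close>

lemma computes_from_list_encode_Cons:
  assumes "computes_from N h" "computes_from N (\<lambda>\<sigma>. list_encode (t \<sigma>))"
  shows "computes_from N (\<lambda>\<sigma>. list_encode (h \<sigma> # t \<sigma>))"
  using computes_from_Suc[OF computes_from_prod_encode[OF assms]] by simp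

text \<open>Each further instruction of the block is one more \<open>Cons\<close>, so the code of
  the list obeys a primitive recursion starting from the constant code of \<open>L\<close>. The last
  entry 0 in \<open>?step\<close> is the code of \<open>Move_Left\<close>.\<close>

lemma computable_code_of_block_machine:
  "computable (\<lambda>n. prod_encode (a, machine_code (b + n, block t b n @ L)))"
proof (rule computableI)
  let ?step = "\<lambda>j x. Suc (prod_encode (list_encode [b + j + 1, t, 0, b + j, 1, 0], x))"
  have "list_encode (map instruction_code (block t b n @ L)) =
      rec_nat (list_encode (map instruction_code L)) ?step n" for n
    by (induction n) (simp_all add: instruction_code_def)
  then have code: "machine_code (b + n, block t b n @ L) =
      prod_encode (b + n, rec_nat (list_encode (map instruction_code L)) ?step n)" for n
    by (simp add: machine_code_def)
  show "computes_from 1 (\<lambda>\<sigma>. prod_encode (a, machine_code (b + \<sigma> 0, block t b (\<sigma> 0) @ L)))"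
    unfolding code
    by (intro computes_from_prod_encode computes_from_rec computes_from_Suc computes_from_add
        computes_from_list_encode_Cons computes_from_const computes_from_var) auto
qed

section \<open>Codes are unambiguous\<close>

lemma inj_vector_code: "inj (vector_code :: int ^ 'd::finite \<Rightarrow> nat)"
proof (rule injI)
  fix v w :: "int ^ 'd"
  assume "vector_code v = vector_code w"
  then have eq: "v $ from_nat_into UNIV i = w $ from_nat_into UNIV i" if "i < CARD('d)" for i
    using that by (simp add: vector_code_def list_encode_eq int_encode_eq)
  have "v $ j = w $ j" for j
    using eq bij_betw_from_nat_into_finite[OF finite_class.finite_UNIV[where 'a = 'd]]
    unfolding bij_betw_def by (metis UNIV_I imageE lessThan_iff)
  then show "v = w" by (simp add: vec_eq_iff)
qed

text \<open>\<open>set_encode\<close> is injective only on finite sets, which is why the claim is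
  restricted to patterns with finite domain.\<close>

lemma inj_on_pattern_code: "inj_on (pattern_code :: 'd::finite pattern \<Rightarrow> nat) (patterns A)"
proof (rule inj_onI)
  fix p r :: "'d pattern"
  assume pr: "p \<in> patterns A" "r \<in> patterns A" and eq: "pattern_code p = pattern_code r"
  let ?f = "\<lambda>(s :: int ^ 'd, a :: nat). prod_encode (vector_code s, a)"
  have fin: "finite (Map.graph u)" if "u \<in> patterns A" for u :: "'d pattern"
    using that by (simp add: patterns_def)
  have "inj ?f"
    using inj_vector_code by (auto simp: inj_on_def)
  moreover have "?f ` Map.graph p = ?f ` Map.graph r"
    using eq fin[OF pr(1), THEN finite_imageI, of ?f] fin[OF pr(2), THEN finite_imageI, of ?f]
    by (simp only: pattern_code_def set_encode_eq)
  ultimately have "Map.graph p = Map.graph r" by (simp add: inj_image_eq_iff)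
  then have "p s = Some a \<longleftrightarrow> r s = Some a" for s a
    by (metis in_graphI in_graphD)
  then show "p = r" by (metis option.exhaust ext)
qed

lemma inj_instruction_code: "inj instruction_code"
proof (rule injI)
  have "inj move_code" by (rule injI) (elim move_code.elims; simp)
  then show "x = y" if "instruction_code x = instruction_code y" for x y
    using that by (auto simp: instruction_code_def inj_eq split: prod.splits)
qed

lemma inj_machine_code: "inj machine_code"
  by (rule injI) (auto simp: machine_code_def list_encode_eq inj_map_eq_map[OF inj_instruction_code] prod_eq_iff)

text \<open>Needed for negative instances: a code that specifies a subshift other than
  \<open>Y\<close> must not specify \<open>Y\<close> as well.\<close>

lemma specifies_unique:
  fixes X X' :: "'d::finite configuration set"
  assumes "specifies c X" "specifies c X'"
  shows "X = X'"
proof -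
  obtain A M F where 1: "finite A" "F \<subseteq> patterns A" "enumerates_patterns M F"
    "c = prod_encode (set_encode A, machine_code M)" "X = subshift A F"
    using assms(1) unfolding specifies_def by blast
  obtain A' M' F' where 2: "finite A'" "F' \<subseteq> patterns A'" "enumerates_patterns M' F'"
    "c = prod_encode (set_encode A', machine_code M')" "X' = subshift A' F'"
    using assms(2) unfolding specifies_def by blast
  have "A = A'" "M = M'"
    using 1(1,4) 2(1,4) inj_machine_code by (auto simp: set_encode_eq inj_eq)
  moreover from this have "pattern_code ` F = pattern_code ` F'"
    using 1(3) 2(3) by (simp add: enumerates_patterns_def)
  ultimately have "F = F'"
    using 1(2) 2(2) inj_on_image_eq_iff[OF inj_on_pattern_code] by metis
  then show ?thesis using 1(5) 2(5) \<open>A = A'\<close> by simp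
qed

section \<open>The reduction\<close>

lemma empty_pattern_appears: "appears_in Map.empty x"
  by (simp add: appears_in_def)

text \<open>The one-cell pattern appears exactly where the symbol occurs, so forbidding it shrinks
  the alphabet back to \<open>A\<close>.\<close>

lemma subshift_forbid_symbol:
  assumes "F \<subseteq> patterns A" "c \<notin> A"
  shows "subshift (insert c A) (insert [0 \<mapsto> c] F) = subshift A F"
proof -
  have "appears_in [0 \<mapsto> c] x \<longleftrightarrow> c \<in> range x" for x :: "'a configuration"
    by (auto simp: appears_in_def)
  then show ?thesis using assms(2) by (auto simp: subshift_def)
qed

text \<open>A nonempty pattern appearing in the constant configuration takes the value
  \<open>c\<close>, whereas the patterns in \<open>F\<close> take values in
  \<open>A\<close>.\<close>

lemma constant_in_subshift:
  assumes "F \<subseteq> patterns A" "c \<notin> A" "Map.empty \<notin> F"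
  shows "(\<lambda>_. c) \<in> subshift (insert c A) F"
proof -
  have "\<not> appears_in p (\<lambda>_. c)" if "p \<in> F" for p
  proof
    assume "appears_in p (\<lambda>_. c)"
    then have "\<forall>s\<in>dom p. p s = Some c" unfolding appears_in_def by blast
    moreover have "p \<noteq> Map.empty" using \<open>p \<in> F\<close> assms(3) by blast
    then obtain s where "s \<in> dom p" using dom_eq_empty_conv[of p] by blast
    ultimately have "p s = Some c" by blast
    then have "c \<in> ran p" by (rule ranI)
    moreover have "ran p \<subseteq> A" using assms(1) \<open>p \<in> F\<close> unfolding patterns_def by blast
    ultimately show False using assms(2) by blast
  qed
  then show ?thesis by (auto simp: subshift_def)
qed

theorem theorem7p1:
  fixes Y :: "(int ^ 'd::finite \<Rightarrow> nat) set"
  assumes "effective_subshift Y" and "Y \<noteq> {}"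
  shows "hard_for D_Sigma01 (equality_problem Y)"
  unfolding hard_for_def
proof
  fix S assume "S \<in> D_Sigma01"
  then obtain R1 R2 where R: "decidable2 R1" "decidable2 R2"
    and S: "S = {n. \<exists>k. R1 n k} - {n. \<exists>k. R2 n k}"
    unfolding D_Sigma01_def Sigma01_def by blast
  obtain A M and F :: "'d pattern set" where A: "finite A" and F: "F \<subseteq> patterns A"
    and M: "enumerated_set M = pattern_code ` F" and Y: "Y = subshift A F"
    using assms(1) unfolding effective_subshift_def enumerates_patterns_def by blast
  obtain c where c: "c \<notin> A" using A ex_new_if_finite infinite_UNIV_nat by blast
  let ?star = "[0 \<mapsto> c] :: 'd pattern"
  obtain b L where bL: "\<And>n. enumerated_set (b + n, block 1 b n @ L) =
      {y. \<exists>k. outputs M [k] y \<or> (R1 n k \<and> y = pattern_code ?star) \<or>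
        (R2 n k \<and> y = pattern_code (Map.empty :: 'd pattern))}"
    using enumerating_machines[OF semidecides_outputs semidecides_decidable2[OF R(1)]
        semidecides_decidable2[OF R(2)]] by blast
  \<comment> \<open>Each comprehension has at most one element: all witnesses \<open>k\<close>
    contribute the same pattern.\<close>
  define G where "G n = F \<union> {?star | k. R1 n k} \<union> {Map.empty | k. R2 n k}" for n
  define X where "X n = subshift (insert c A) (G n)" for n
  define f where "f n = prod_encode (set_encode (insert c A), machine_code (b + n, block 1 b n @ L))"
    for n
  have "computable f"
    unfolding f_def by (rule computable_code_of_block_machine)
  have spec: "specifies (f n) (X n)" for n
  proof -
    have "patterns A \<subseteq> patterns (insert c A)" by (auto simp: patterns_def)
    then have "G n \<subseteq> patterns (insert c A)"
      using F by (auto simp: G_def patterns_def)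
    moreover have "enumerates_patterns (b + n, block 1 b n @ L) (G n)"
      unfolding enumerates_patterns_def bL
      using M by (auto simp: G_def enumerated_set_def)
    ultimately show ?thesis
      unfolding specifies_def X_def f_def using A by blast
  qed
  have X: "X n = Y \<longleftrightarrow> n \<in> S" for n
  proof (cases "\<exists>k. R2 n k")
    case True
    then have "X n = {}"
      by (auto simp: X_def G_def subshift_def empty_pattern_appears)
    then show ?thesis using True assms(2) S by auto
  next
    case no_R2: False
    show ?thesis
    proof (cases "\<exists>k. R1 n k")
      case True
      then have "G n = insert ?star F" using no_R2 by (auto simp: G_def)
      then show ?thesis
        using True no_R2 S subshift_forbid_symbol[OF F c] by (simp add: X_def Y)
    next
      case False
      then have "G n = F" using no_R2 by (auto simp: G_def)
      \<comment> \<open>The empty pattern appears in every configuration, so forbidding it would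
        make \<open>Y\<close> empty.\<close>
      moreover have "Map.empty \<notin> F"
        using assms(2) by (auto simp: Y subshift_def empty_pattern_appears)
      ultimately have "(\<lambda>_. c) \<in> X n"
        using constant_in_subshift[OF F c] by (simp add: X_def)
      moreover have "(\<lambda>_. c) \<notin> Y" using c by (auto simp: Y subshift_def)
      ultimately show ?thesis using False S by auto
    qed
  qed
  \<comment> \<open>By uniqueness, the existential quantifier in the equality problem refers to
    \<open>X n\<close> alone.\<close>
  have "(\<exists>Z :: 'd configuration set. specifies (f n) Z \<and> Z = Y) \<longleftrightarrow> X n = Y" for n
    using spec[of n] specifies_unique[OF spec[of n]] by blast
  then have "f n \<in> fst (equality_problem Y) \<and> (n \<in> S \<longleftrightarrow> f n \<in> snd (equality_problem Y))" for n
    using spec[of n] unfolding X by (auto simp: equality_problem_def)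
  with \<open>computable f\<close> show "many_one_reducible S (equality_problem Y)"
    unfolding many_one_reducible_def by blast
qed

end
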